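(* Let $G=([n],E)$ be a tensegrity graph with no cables ($C=\emptyset$), and let $G(\mathbf p)\subseteq\mathbb R^d$ be a generalized least eigenvalue framework of $G$. Then $G(\mathbf p)$ is universally completable if and only if the following holds: for every symmetric matrix $R\in\mathcal S^d$ with $\operatorname{im}R\subseteq\operatorname{span}(p_1,\dots,p_n)$, $$p_i^TRp_j=0 \text{ for all } i\simeq j \ \Longrightarrow\ R=0.$$
   Context: A tensegrity graph is a graph $G=([n],E)$ whose edge set is partitioned into three disjoint sets $B$ (bars), $C$ (cables) and $S$ (struts). A tensegrity framework $G(\mathbf p)$ consists of a tensegrity graph and an assignment of real column vectors $\mathbf p=(p_1,\dots,p_n)$ to its vertices; if all $p_i\in\mathbb R^d$ we write $G(\mathbf p)\subseteq\mathbb R^d$. $\mathrm{Gram}(p_1,\dots,p_n)$ is the $n\times n$ matrix with entries $p_i^Tp_j$. For two frameworks $G(\mathbf p)$ and $G(\mathbf q)$ (the $q_i$ may lie in a real space of any dimension), $G(\mathbf p)$ dominates $G(\mathbf q)$ if $q_i^Tq_j=p_i^Tp_j$ for $ij\in B$ and for $i=j$, $q_i^Tq_j\ge p_i^Tp_j$ for $ij\in C$, and $q_i^Tq_j\le p_i^Tp_j$ for $ij\in S$. $G(\mathbf p)$ is universally completable if every framework $G(\mathbf q)$ dominated by $G(\mathbf p)$ satisfies $\mathrm{Gram}(q_1,\dots,q_n)=\mathrm{Gram}(p_1,\dots,p_n)$. The adjacency matrix $A$ of a tensegrity graph is that of the underlying graph with edge set $B\cup C\cup S$. A generalized least eigenvalue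 framework of $G$ is given by taking $p_i^T$ to be the $i$-th row of a real $n\times d$ matrix $P$ whose columns span the eigenspace of $A$ for its least eigenvalue $\lambda_{\min}(A)$. We write $i\sim j$ for adjacency and $i\simeq j$ for "$i=j$ or $i\sim j$"; $\mathcal S^d$ is the set of real symmetric $d\times d$ matrices. *)

theory Defs
  imports "Jordan_Normal_Form.VS_Connect" "Jordan_Normal_Form.Spectral_Radius"
begin

text \<open>
  The vertex set \<open>[n]\<close> is rendered as \<open>{0, ..., n - 1}\<close>, matching the 0-based indexing of vectors
  and matrices. Edges are two-element subsets of the vertex set. The dimension of a framework is a
  natural number (not a type), so that frameworks of all dimensions can be compared.
\<close>

record tensegrity =
  num_verts :: nat
  bars :: "nat set set"
  cables :: "nat set set"
  struts :: "nat set set"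

definition edges :: "tensegrity \<Rightarrow> nat set set" where
  "edges G = bars G \<union> cables G \<union> struts G"

definition tensegrity_graph :: "tensegrity \<Rightarrow> bool" where
  "tensegrity_graph G \<longleftrightarrow>
     edges G \<subseteq> {{i, j} | i j. i < num_verts G \<and> j < num_verts G \<and> i \<noteq> j} \<and>
     bars G \<inter> cables G = {} \<and> bars G \<inter> struts G = {} \<and> cables G \<inter> struts G = {}"

definition adjacent :: "tensegrity \<Rightarrow> nat \<Rightarrow> nat \<Rightarrow> bool" where
  "adjacent G i j \<longleftrightarrow> {i, j} \<in> edges G"

definition adjacent_or_eq :: "tensegrity \<Rightarrow> nat \<Rightarrow> nat \<Rightarrow> bool" where
  "adjacent_or_eq G i j \<longleftrightarrow> i = j \<or> adjacent G i j"

definition adjacency_mat :: "tensegrity \<Rightarrow> real mat" where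
  "adjacency_mat G =
     mat (num_verts G) (num_verts G) (\<lambda>(i, j). if adjacent G i j then 1 else 0)"

text \<open>Only the values of an assignment \<open>p\<close> at vertices matter; the others are arbitrary.\<close>

definition framework :: "tensegrity \<Rightarrow> nat \<Rightarrow> (nat \<Rightarrow> real vec) \<Rightarrow> bool" where
  "framework G d p \<longleftrightarrow> (\<forall>i < num_verts G. p i \<in> carrier_vec d)"

definition gram_mat :: "nat \<Rightarrow> (nat \<Rightarrow> real vec) \<Rightarrow> real mat" where
  "gram_mat n p = mat n n (\<lambda>(i, j). p i \<bullet> p j)"

definition dominates :: "tensegrity \<Rightarrow> (nat \<Rightarrow> real vec) \<Rightarrow> (nat \<Rightarrow> real vec) \<Rightarrow> bool" where
  "dominates G p q \<longleftrightarrow>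
     (\<forall>i < num_verts G. \<forall>j < num_verts G.
        ({i, j} \<in> bars G \<or> i = j \<longrightarrow> q i \<bullet> q j = p i \<bullet> p j) \<and>
        ({i, j} \<in> cables G \<longrightarrow> q i \<bullet> q j \<ge> p i \<bullet> p j) \<and>
        ({i, j} \<in> struts G \<longrightarrow> q i \<bullet> q j \<le> p i \<bullet> p j))"

definition universally_completable :: "tensegrity \<Rightarrow> (nat \<Rightarrow> real vec) \<Rightarrow> bool" where
  "universally_completable G p \<longleftrightarrow>
     (\<forall>k q. framework G k q \<longrightarrow> dominates G p q \<longrightarrow>
        gram_mat (num_verts G) q = gram_mat (num_verts G) p)"

definition least_eigenvalue :: "real mat \<Rightarrow> real" where
  "least_eigenvalue A = Min (spectrum A)"

definition eigenspace :: "real mat \<Rightarrow> real \<Rightarrow> real vec set" where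
  "eigenspace A k = {v \<in> carrier_vec (dim_row A). A *\<^sub>v v = k \<cdot>\<^sub>v v}"

text \<open>The columns of \<open>P\<close> need not be linearly independent.\<close>

definition generalized_least_eigenvalue_framework ::
  "tensegrity \<Rightarrow> nat \<Rightarrow> (nat \<Rightarrow> real vec) \<Rightarrow> bool" where
  "generalized_least_eigenvalue_framework G d p \<longleftrightarrow>
     (\<exists>P \<in> carrier_mat (num_verts G) d.
        vec_space.col_space (num_verts G) P
          = eigenspace (adjacency_mat G) (least_eigenvalue (adjacency_mat G)) \<and>
        (\<forall>i < num_verts G. p i = row P i))"

definition mat_image :: "real mat \<Rightarrow> real vec set" where
  "mat_image R = (\<lambda>x. R *\<^sub>v x) ` carrier_vec (dim_col R)"

abbreviation vec_span :: "nat \<Rightarrow> real vec set \<Rightarrow> real vec set" where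
  "vec_span d \<equiv> LinearCombinations.module.span class_ring (module_vec TYPE(real) d)"

end

theory Submission
  imports Defs "HOL-Analysis.Function_Topology"
begin

text \<open>
  Let \<open>A\<close> be the adjacency matrix and \<open>\<mu>\<close> its least eigenvalue, so that \<open>A - \<mu> I\<close> is positive
  semidefinite. If \<open>q\<close> is dominated by \<open>p\<close>, then, as there are no cables, the trace of \<open>A - \<mu> I\<close>
  against the Gram matrix of \<open>q\<close> is at most the one against the Gram matrix of \<open>p\<close>, which is \<open>0\<close>.
  Hence the columns of \<open>Q\<close> also lie in the eigenspace, all strut inequalities are tight, and
  \<open>q\<^sub>i = U p\<^sub>i\<close> and \<open>p\<^sub>i = T p\<^sub>i\<close> for matrices \<open>U\<close>, \<open>T\<close> whose rows lie in the span of the \<open>p\<^sub>i\<close>. The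
  difference of the Gram matrices is the form \<open>R = U\<^sup>T U - T\<^sup>T T\<close> on the \<open>p\<^sub>i\<close>, and \<open>R\<close> vanishes on
  all edges. Conversely, for a nonzero \<open>R\<close> vanishing on all edges, \<open>I + \<epsilon> R\<close> has the form \<open>U\<^sup>T U\<close> for
  small \<open>\<epsilon>\<close>, and \<open>q\<^sub>i = U p\<^sub>i\<close> is dominated by \<open>p\<close> with a different Gram matrix.
\<close>

section \<open>The least eigenvalue as the minimum of the quadratic form\<close>

lemma scalar_prod_self_eq_0_iff:
  fixes x :: "real vec"
  assumes "x \<in> carrier_vec n"
  shows "x \<bullet> x = 0 \<longleftrightarrow> x = 0\<^sub>v n"
proof -
  have "conjugate x = x" by (intro eq_vecI) auto
  then show ?thesis using conjugate_square_eq_0_vec[OF assms] by simp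
qed

lemma scalar_prod_self_nonneg: "(x :: real vec) \<bullet> x \<ge> 0"
  unfolding scalar_prod_def by (intro sum_nonneg) simp

text \<open>The form of \<open>A - \<mu> I\<close> is nonnegative and vanishes at \<open>x\<close>,
  so \<open>x\<close> minimizes it and its derivative there is zero in every direction. In the
  direction of the residual \<open>A x - \<mu> x\<close> that derivative is twice the squared norm
  of the residual.\<close>

lemma quadratic_form_minimizer_eigenvector:
  fixes A :: "real mat"
  assumes A: "A \<in> carrier_mat n n" and sym: "transpose_mat A = A"
    and le: "\<And>y. y \<in> carrier_vec n \<Longrightarrow> \<mu> * (y \<bullet> y) \<le> y \<bullet> (A *\<^sub>v y)"
    and x: "x \<in> carrier_vec n" and eq: "x \<bullet> (A *\<^sub>v x) = \<mu> * (x \<bullet> x)"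
  shows "A *\<^sub>v x = \<mu> \<cdot>\<^sub>v x"
proof -
  define y where "y = A *\<^sub>v x - \<mu> \<cdot>\<^sub>v x"
  have y: "y \<in> carrier_vec n" using A x by (simp add: y_def)
  have Ax: "A *\<^sub>v x \<in> carrier_vec n" and Ay: "A *\<^sub>v y \<in> carrier_vec n" using A x y by auto
  have yy: "y \<bullet> (A *\<^sub>v x) - \<mu> * (y \<bullet> x) = y \<bullet> y"
    using scalar_prod_minus_distrib[OF y Ax, of "\<mu> \<cdot>\<^sub>v x"] x y unfolding y_def[symmetric] by simp
  have xAy: "x \<bullet> (A *\<^sub>v y) = y \<bullet> (A *\<^sub>v x)"
    using transpose_vec_mult_scalar[OF A y x] comm_scalar_prod[OF Ax y] sym by simp
  define z where "z = y \<bullet> (A *\<^sub>v y) - \<mu> * (y \<bullet> y)"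
  have z: "z \<ge> 0" using le[OF y] by (simp add: z_def)
  \<comment> \<open>First variation at \<open>x\<close> in the direction of the residual \<open>y\<close>.\<close>
  have *: "2 * t * (y \<bullet> y) \<le> t\<^sup>2 * z" for t
  proof -
    let ?w = "x - t \<cdot>\<^sub>v y"
    have w: "?w \<in> carrier_vec n" using x y by simp
    have ty: "t \<cdot>\<^sub>v y \<in> carrier_vec n" using y by simp
    have Aw: "A *\<^sub>v ?w = A *\<^sub>v x - t \<cdot>\<^sub>v (A *\<^sub>v y)"
      using A x y by (simp add: mult_minus_distrib_mat_vec mult_mat_vec)
    have tAy: "t \<cdot>\<^sub>v (A *\<^sub>v y) \<in> carrier_vec n" using Ay by simp
    have wAw: "?w \<bullet> (A *\<^sub>v ?w) = x \<bullet> (A *\<^sub>v x) - 2 * t * (y \<bullet> (A *\<^sub>v x)) + t\<^sup>2 * (y \<bullet> (A *\<^sub>v y))"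
      unfolding Aw using x y ty Ax Ay tAy xAy
      by (simp add: minus_scalar_prod_distrib[of _ n] scalar_prod_minus_distrib[of _ n] power2_eq_square algebra_simps)
    have ww: "?w \<bullet> ?w = x \<bullet> x - 2 * t * (y \<bullet> x) + t\<^sup>2 * (y \<bullet> y)"
      using x y ty comm_scalar_prod[OF x y]
      by (simp add: minus_scalar_prod_distrib[of _ n] scalar_prod_minus_distrib[of _ n] power2_eq_square algebra_simps)
    have "0 \<le> - 2 * t * (y \<bullet> (A *\<^sub>v x) - \<mu> * (y \<bullet> x)) + t\<^sup>2 * z"
      using le[OF w, unfolded wAw ww] eq unfolding z_def by (simp add: algebra_simps)
    then show ?thesis unfolding yy by simp
  qed
  have "y \<bullet> y \<le> 0"
  proof (rule ccontr)
    assume "\<not> y \<bullet> y \<le> 0"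
    then have s: "y \<bullet> y > 0" by simp
    \<comment> \<open>A step short enough that \<open>t * z\<close> cannot exceed
      \<open>y \<bullet> y\<close>, against the bound
      \<open>2 * (y \<bullet> y) \<le> t * z\<close>. The added 1 keeps the denominator positive
      when \<open>z = 0\<close>.\<close>
    define t where "t = (y \<bullet> y) / (z + 1)"
    have t: "t > 0" using s z by (simp add: t_def)
    have "2 * (y \<bullet> y) \<le> t * z" using *[of t] t by (simp add: power2_eq_square)
    moreover have "t * (z + 1) = y \<bullet> y" using z by (simp add: t_def)
    then have "t * z \<le> y \<bullet> y" using t by (simp add: algebra_simps)
    ultimately show False using s by simp
  qed
  then have "y = 0\<^sub>v n"
    using scalar_prod_self_eq_0_iff[OF y] scalar_prod_self_nonneg[of y] by simp
  then have "A *\<^sub>v x - \<mu> \<cdot>\<^sub>v x = 0\<^sub>v n" by (simp add: y_def)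
  then show ?thesis using A x
    by (intro eq_vecI) (auto dest: arg_cong[where f = "\<lambda>v. v $ _"] simp: vec_eq_iff)
qed

lemma scalar_prod_mult_mat_vec_eq_sum:
  fixes A :: "real mat"
  assumes "A \<in> carrier_mat n m" "x \<in> carrier_vec n" "y \<in> carrier_vec m"
  shows "x \<bullet> (A *\<^sub>v y) = (\<Sum>i<n. \<Sum>j<m. A $$ (i, j) * (x $ i * y $ j))"
  using assms unfolding scalar_prod_def
  by (auto simp: lessThan_atLeast0 sum_distrib_left scalar_prod_def intro!: sum.cong)

lemma continuous_on_coordinate: "continuous_on S (\<lambda>f :: nat \<Rightarrow> real. f i)"
  by (rule continuous_on_subset[OF continuous_on_product_coordinates]) simp

text \<open>Vectors of dimension \<open>n\<close> are modelled as functions that vanish from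
  \<open>n\<close> on, so that the product topology applies. The sphere is then a closed subset of a
  product of intervals and singletons, which is compact by Tychonoff.\<close>

lemma compact_sphere_fun:
  "compact {f :: nat \<Rightarrow> real. (\<Sum>i<n. (f i)\<^sup>2) = 1 \<and> (\<forall>i\<ge>n. f i = 0)}"
proof -
  let ?K = "PiE UNIV (\<lambda>i. if i < n then {-1..1::real} else {0})"
  let ?g = "\<lambda>f. \<Sum>i<n. (f i :: real)\<^sup>2"
  have "compactin (product_topology (\<lambda>_. euclidean) UNIV) ?K"
    unfolding compactin_PiE by (auto simp: compactin_euclidean_iff)
  then have K: "compact ?K"
    by (simp add: euclidean_product_topology compactin_euclidean_iff)
  have cl: "closed (?g -` {1})"
    by (rule closed_vimage[OF closed_singleton])
      (intro continuous_on_sum continuous_on_power continuous_on_coordinate)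
  have "compact (?K \<inter> ?g -` {1})" by (rule compact_Int_closed[OF K cl])
  moreover have "{f. ?g f = 1 \<and> (\<forall>i\<ge>n. f i = 0)} = ?K \<inter> ?g -` {1}"
  proof -
    have "\<bar>f i\<bar> \<le> 1" if "?g f = 1" "i < n" for f i
    proof -
      have "(f i)\<^sup>2 \<le> ?g f" by (rule member_le_sum) (use that in auto)
      then show ?thesis using that by (simp add: abs_square_le_1)
    qed
    then have bound: "f i \<in> {-1..1}" if "?g f = 1" "i < n" for f i
      using that by (auto simp: abs_le_iff minus_le_iff)
    show ?thesis
    proof (intro equalityI subsetI)
      fix f assume "f \<in> {f. ?g f = 1 \<and> (\<forall>i\<ge>n. f i = 0)}"
      then have 1: "?g f = 1" and 0: "\<forall>i\<ge>n. f i = 0" by blast+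
      have "f i \<in> (if i < n then {-1..1} else {0})" for i
        using bound[OF 1, of i] 0 by (cases "i < n") (simp_all only: if_True if_False, simp)
      then have "f \<in> ?K" unfolding PiE_UNIV_domain by (rule Pi_I)
      moreover have "f \<in> ?g -` {1}" using 1 by simp
      ultimately show "f \<in> ?K \<inter> ?g -` {1}" ..
    next
      fix f assume f: "f \<in> ?K \<inter> ?g -` {1}"
      then have "f \<in> ?K" and g: "f \<in> ?g -` {1}" by blast+
      then have "f i \<in> (if i < n then {-1..1} else {0})" for i using PiE_mem[of f UNIV _ i] by blast
      then have "f i = 0" if "i \<ge> n" for i using that by (metis not_le singletonD)
      then show "f \<in> {f. ?g f = 1 \<and> (\<forall>i\<ge>n. f i = 0)}" using g by simp
    qed
  qed
  ultimately show ?thesis by simp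
qed

text \<open>A continuous function attains its minimum on the compact unit sphere, and homogeneity of
  degree two carries the bound from the sphere to all vectors.\<close>

lemma quadratic_form_attains_min:
  fixes A :: "real mat"
  assumes A: "A \<in> carrier_mat n n" and n: "n > 0"
  obtains x where "x \<in> carrier_vec n" "x \<bullet> x = 1"
    "\<And>y. y \<in> carrier_vec n \<Longrightarrow> x \<bullet> (A *\<^sub>v x) * (y \<bullet> y) \<le> y \<bullet> (A *\<^sub>v y)"
proof -
  let ?S = "{f :: nat \<Rightarrow> real. (\<Sum>i<n. (f i)\<^sup>2) = 1 \<and> (\<forall>i\<ge>n. f i = 0)}"
  let ?q = "\<lambda>f :: nat \<Rightarrow> real. \<Sum>i<n. \<Sum>j<n. A $$ (i, j) * (f i * f j)"
  \<comment> \<open>The first unit vector shows that the sphere is nonempty; this is where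
    \<open>n > 0\<close> enters.\<close>
  define e :: "nat \<Rightarrow> real" where "e i = (if i = 0 then 1 else 0)" for i
  have "(\<Sum>i<n. (e i)\<^sup>2) = (\<Sum>i<n. if i = 0 then 1 else 0)"
    by (intro sum.cong) (simp_all add: e_def)
  also have "\<dots> = 1" using n by (subst sum.delta) simp_all
  finally have "e \<in> ?S" using n by (simp add: e_def)
  then have "?S \<noteq> {}" by blast
  moreover have "continuous_on ?S ?q"
    by (intro continuous_on_sum continuous_on_mult continuous_on_const continuous_on_coordinate)
  ultimately have "\<exists>f\<in>?S. \<forall>g\<in>?S. ?q f \<le> ?q g"
    by (rule continuous_attains_inf[OF compact_sphere_fun])
  then obtain f where f: "f \<in> ?S" and min: "\<forall>g\<in>?S. ?q f \<le> ?q g" ..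
  have q: "vec n g \<bullet> (A *\<^sub>v vec n g) = ?q g" for g
    using scalar_prod_mult_mat_vec_eq_sum[OF A, of "vec n g" "vec n g"] by simp
  show thesis
  proof
    show "vec n f \<in> carrier_vec n" by simp
    show "vec n f \<bullet> vec n f = 1"
      using f by (simp add: scalar_prod_def lessThan_atLeast0 power2_eq_square)
    fix y :: "real vec" assume y: "y \<in> carrier_vec n"
    show "vec n f \<bullet> (A *\<^sub>v vec n f) * (y \<bullet> y) \<le> y \<bullet> (A *\<^sub>v y)"
    proof (cases "y \<bullet> y = 0")
      case True
      then show ?thesis using scalar_prod_self_eq_0_iff[OF y] A by simp
    next
      case False
      define s where "s = y \<bullet> y"
      have s: "s > 0" using False scalar_prod_self_nonneg[of y] by (simp add: s_def)
      \<comment> \<open>The vector \<open>y\<close> scaled to norm 1 and extended by zero, hence a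
        point of the sphere.\<close>
      define g where "g i = (if i < n then y $ i / sqrt s else 0)" for i
      have "(\<Sum>i<n. (g i)\<^sup>2) = (\<Sum>i<n. (y $ i)\<^sup>2) / s"
        unfolding sum_divide_distrib using s by (intro sum.cong) (auto simp: g_def power_divide)
      also have "(\<Sum>i<n. (y $ i)\<^sup>2) = s"
        using y by (simp add: s_def scalar_prod_def lessThan_atLeast0 power2_eq_square)
      finally have "g \<in> ?S" using s by (simp add: g_def)
      moreover have "?q g = (\<Sum>i<n. \<Sum>j<n. A $$ (i, j) * (y $ i * y $ j)) / s"
        unfolding sum_divide_distrib using s by (intro sum.cong) (auto simp: g_def)
      ultimately have "?q f \<le> (y \<bullet> (A *\<^sub>v y)) / s"
        using bspec[OF min, of g] scalar_prod_mult_mat_vec_eq_sum[OF A y y] by simp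
      then show ?thesis using s unfolding q s_def by (simp add: field_simps)
    qed
  qed
qed

text \<open>The minimum of the form on the unit sphere is attained at an eigenvector and equals its
  eigenvalue, so it is at least the least eigenvalue. In other words, \<open>A\<close> minus its
  least eigenvalue times the identity is positive semidefinite.\<close>

lemma least_eigenvalue_le_quadratic_form:
  assumes A: "A \<in> carrier_mat n n" and sym: "transpose_mat A = A" and y: "y \<in> carrier_vec n"
  shows "least_eigenvalue A * (y \<bullet> y) \<le> y \<bullet> (A *\<^sub>v y)"
proof (cases "n = 0")
  \<comment> \<open>Here the spectrum is empty and \<open>least_eigenvalue A\<close> is unspecified,
    but both sides are zero whatever its value.\<close>
  case True
  then show ?thesis using A y by (simp add: scalar_prod_def)
next
  case False
  then obtain x where x: "x \<in> carrier_vec n" and 1: "x \<bullet> x = 1"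
    and min: "\<And>y. y \<in> carrier_vec n \<Longrightarrow> x \<bullet> (A *\<^sub>v x) * (y \<bullet> y) \<le> y \<bullet> (A *\<^sub>v y)"
    using quadratic_form_attains_min[OF A] by auto
  have "A *\<^sub>v x = (x \<bullet> (A *\<^sub>v x)) \<cdot>\<^sub>v x"
    using quadratic_form_minimizer_eigenvector[OF A sym min x] 1 by simp
  moreover have "x \<noteq> 0\<^sub>v n" using 1 scalar_prod_self_eq_0_iff[OF x] by auto
  ultimately have "x \<bullet> (A *\<^sub>v x) \<in> spectrum A"
    using A x by (auto simp: spectrum_def eigenvalue_def eigenvector_def)
  then have "least_eigenvalue A \<le> x \<bullet> (A *\<^sub>v x)"
    unfolding least_eigenvalue_def using card_finite_spectrum(1)[OF A] by (intro Min_le)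
  then show ?thesis
    using min[OF y] scalar_prod_self_nonneg[of y] by (meson mult_right_mono order_trans)
qed

section \<open>Orthogonal projection and preimages in the row space\<close>

text \<open>Gram-Schmidt, one vector at a time: \<open>r\<close> is the part of the new vector
  \<open>w\<close> orthogonal to \<open>W\<close>, and the projection \<open>y\<close> onto the old
  span is corrected by a multiple of \<open>r\<close>.\<close>

lemma exists_orthogonal_projection:
  fixes x :: "real vec"
  assumes "finite W" "W \<subseteq> carrier_vec d" "x \<in> carrier_vec d"
  shows "\<exists>y\<in>vec_span d W. \<forall>w\<in>W. w \<bullet> (x - y) = 0"
  using assms
proof (induction W arbitrary: x rule: finite_induct)
  case empty
  interpret vec_space "TYPE(real)" d .
  show ?case by (auto simp: span_empty)
next
  case (insert w W)
  interpret vec_space "TYPE(real)" d .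
  have W: "W \<subseteq> carrier_vec d" and w: "w \<in> carrier_vec d" and x: "x \<in> carrier_vec d"
    using insert.prems by auto
  from insert.IH[OF W w] obtain u where u: "u \<in> span W" "\<forall>v\<in>W. v \<bullet> (w - u) = 0" by auto
  from insert.IH[OF W x] obtain y where y: "y \<in> span W" "\<forall>v\<in>W. v \<bullet> (x - y) = 0" by auto
  have uc: "u \<in> carrier_vec d" and yc: "y \<in> carrier_vec d"
    using u y span_closed[of W] W by auto
  define r where "r = w - u"
  \<comment> \<open>The coefficient of \<open>x - y\<close> along \<open>r\<close>. If
    \<open>r = 0\<close>, the quotient is 0 by convention and the equation for \<open>t\<close>
    below still holds.\<close>
  define t where "t = r \<bullet> (x - y) / (r \<bullet> r)"
  have r: "r \<in> carrier_vec d" using w uc by (simp add: r_def)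
  have t: "r \<bullet> (x - y) = t * (r \<bullet> r)"
    using scalar_prod_self_eq_0_iff[OF r] x yc by (cases "r \<bullet> r = 0") (auto simp: t_def)
  define z where "z = y + t \<cdot>\<^sub>v r"
  have zc: "z \<in> carrier_vec d" using yc r by (simp add: z_def)
  have iW: "insert w W \<subseteq> carrier_vec d" using W w by auto
  have sub: "span W \<subseteq> span (insert w W)" by (rule span_is_monotone) auto
  have "w \<in> span (insert w W)" using in_own_span[OF iW] by auto
  moreover have "- u \<in> span (insert w W)"
  proof -
    have "(- 1) \<cdot>\<^sub>v u \<in> span (insert w W)" by (rule smult_in_span[OF iW]) (use u sub in blast)
    moreover have "(- 1) \<cdot>\<^sub>v u = - u" by (intro eq_vecI) auto
    ultimately show ?thesis by simp
  qed
  ultimately have "w + - u \<in> span (insert w W)" by (rule span_add1[OF iW])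
  then have "r \<in> span (insert w W)" using w uc by (simp add: r_def minus_add_uminus_vec)
  then have z: "z \<in> span (insert w W)"
    unfolding z_def by (intro span_add1[OF iW] smult_in_span[OF iW]) (use y sub in blast)+
  have xz: "v \<bullet> (x - z) = v \<bullet> (x - y) - t * (v \<bullet> r)" if "v \<in> carrier_vec d" for v
    unfolding z_def using that x yc r
    by (simp add: scalar_prod_minus_distrib[of _ d] scalar_prod_add_distrib[of _ d] algebra_simps)
  have ortho: "v \<bullet> (x - z) = 0" if "v \<in> W" for v
    using xz[of v] that u y W by (auto simp: r_def)
  \<comment> \<open>Orthogonality to \<open>W\<close> extends to its span and so to
    \<open>u\<close>; together with orthogonality to \<open>r\<close> this settles
    \<open>w = u + r\<close>.\<close>
  have "x - z \<in> orthogonal_complement W"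
    using ortho x zc W comm_scalar_prod[of _ d "x - z"]
    by (fastforce simp: orthogonal_complement_def)
  then have "u \<bullet> (x - z) = 0"
    using u in_orthogonal_complement_span[OF W] x zc uc comm_scalar_prod[of u d "x - z"]
    by (auto simp: orthogonal_complement_def)
  moreover have "r \<bullet> (x - z) = 0" using xz[OF r] t by simp
  ultimately have "w \<bullet> (x - z) = 0"
    using minus_scalar_prod_distrib[OF w uc, of "x - z"] x zc by (simp add: r_def)
  then show ?case using z ortho by auto
qed

lemma mult_mat_vec_unit_vec:
  fixes M :: "real mat"
  assumes "M \<in> carrier_mat n d" "j < d"
  shows "M *\<^sub>v unit_vec d j = col M j"
  using assms by (intro eq_vecI) auto

lemma vec_span_rows:
  fixes P :: "real mat"
  assumes "P \<in> carrier_mat n d"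
  shows "vec_span d (set (rows P)) = {transpose_mat P *\<^sub>v v | v. v \<in> carrier_vec n}"
proof -
  interpret vec_space "TYPE(real)" d .
  have "transpose_mat P \<in> carrier_mat d n" using assms by simp
  from col_space_eq[OF this] show ?thesis
    using assms by (auto simp: col_space_def)
qed

text \<open>Projecting \<open>x\<close> onto the row space of \<open>P\<close> changes it by a
  vector orthogonal to all rows, that is, by an element of the kernel of \<open>P\<close>.\<close>

lemma exists_mult_transpose_eq:
  fixes P :: "real mat"
  assumes P: "P \<in> carrier_mat n d" and x: "x \<in> carrier_vec d"
  shows "\<exists>v\<in>carrier_vec n. P *\<^sub>v (transpose_mat P *\<^sub>v v) = P *\<^sub>v x"
proof -
  have "set (rows P) \<subseteq> carrier_vec d" using P by (auto simp: rows_def)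
  from exists_orthogonal_projection[OF _ this x] vec_span_rows[OF P]
  obtain v where v: "v \<in> carrier_vec n"
    and orth: "\<forall>w\<in>set (rows P). w \<bullet> (x - transpose_mat P *\<^sub>v v) = 0" by auto
  have y: "transpose_mat P *\<^sub>v v \<in> carrier_vec d" using P v by simp
  have "row P i \<bullet> (transpose_mat P *\<^sub>v v) = row P i \<bullet> x" if i: "i < n" for i
  proof -
    have "row P i \<in> set (rows P)" using P i by (auto simp: rows_def)
    then have "row P i \<bullet> (x - transpose_mat P *\<^sub>v v) = 0" using orth by blast
    then show ?thesis using scalar_prod_minus_distrib[of "row P i" d x] P x y i by auto
  qed
  then have "P *\<^sub>v (transpose_mat P *\<^sub>v v) = P *\<^sub>v x" using P by (intro eq_vecI) auto
  then show ?thesis using v by blast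
qed

text \<open>The preimages in the row space are collected column by column. That the right factor has
  the form \<open>P^T V\<close> is what later keeps the image of \<open>R\<close> inside the span of
  the framework vectors.\<close>

lemma exists_mat_factor_mult_transpose:
  fixes P Q :: "real mat"
  assumes P: "P \<in> carrier_mat n d" and Q: "Q \<in> carrier_mat n k"
    and cols: "\<And>c. c < k \<Longrightarrow> \<exists>u\<in>carrier_vec d. col Q c = P *\<^sub>v u"
  shows "\<exists>V\<in>carrier_mat n k. Q = P * (transpose_mat P * V)"
proof -
  have "\<exists>v\<in>carrier_vec n. col Q c = P *\<^sub>v (transpose_mat P *\<^sub>v v)" if "c < k" for c
    using cols[OF that] exists_mult_transpose_eq[OF P] by metis
  then obtain v where v: "\<And>c. c < k \<Longrightarrow> v c \<in> carrier_vec n"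
    "\<And>c. c < k \<Longrightarrow> col Q c = P *\<^sub>v (transpose_mat P *\<^sub>v v c)" by metis
  define V where "V = mat n k (\<lambda>(i, c). v c $ i)"
  have V: "V \<in> carrier_mat n k" by (simp add: V_def)
  have PV: "transpose_mat P * V \<in> carrier_mat d k" using P V by simp
  have "col V c = v c" if "c < k" for c
    using v(1)[OF that] that by (intro eq_vecI) (auto simp: V_def)
  then have "col (P * (transpose_mat P * V)) c = col Q c" if "c < k" for c
    using that v(2)[OF that] col_mult2[OF P PV that] col_mult2[OF _ V that, of "transpose_mat P" d] P
    by simp
  then have "Q = P * (transpose_mat P * V)"
    using P Q V by (intro mat_col_eqI) auto
  then show ?thesis using V by blast
qed

section \<open>Symmetric forms: vanishing on a span, and sums of squares\<close>

text \<open>Such a \<open>u\<close> is orthogonal to the whole span, in particular to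
  itself.\<close>

lemma in_vec_span_orthogonal_eq_0:
  fixes u :: "real vec"
  assumes W: "W \<subseteq> carrier_vec d" and u: "u \<in> carrier_vec d" "u \<in> vec_span d W"
    and orth: "\<And>w. w \<in> W \<Longrightarrow> w \<bullet> u = 0"
  shows "u = 0\<^sub>v d"
proof -
  interpret vec_space "TYPE(real)" d .
  have "u \<in> orthogonal_complement W"
    using orth W u comm_scalar_prod[OF u(1)] by (auto simp: orthogonal_complement_def)
  then have "u \<bullet> u = 0"
    using in_orthogonal_complement_span[OF W] u by (auto simp: orthogonal_complement_def)
  then show ?thesis using scalar_prod_self_eq_0_iff[OF u(1)] by simp
qed

text \<open>Orthogonality is used twice. For \<open>w\<close> in \<open>W\<close>, the vector
  \<open>R w\<close> lies in the span and is orthogonal to \<open>W\<close>, so it is zero. By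
  symmetry every \<open>R x\<close> is then orthogonal to \<open>W\<close>, and it also lies in the
  span.\<close>

lemma symmetric_mat_eq_0_if_form_vanishes_on_span:
  fixes R :: "real mat"
  assumes R: "R \<in> carrier_mat d d" and sym: "transpose_mat R = R"
    and W: "W \<subseteq> carrier_vec d" and im: "mat_image R \<subseteq> vec_span d W"
    and van: "\<And>v w. v \<in> W \<Longrightarrow> w \<in> W \<Longrightarrow> v \<bullet> (R *\<^sub>v w) = 0"
  shows "R = 0\<^sub>m d d"
proof -
  have span: "R *\<^sub>v x \<in> vec_span d W" and c: "R *\<^sub>v x \<in> carrier_vec d" if "x \<in> carrier_vec d" for x
    using im R that by (auto simp: mat_image_def)
  have RW: "R *\<^sub>v w = 0\<^sub>v d" if "w \<in> W" for w
    using in_vec_span_orthogonal_eq_0[OF W c span] van W that by blast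
  have "R *\<^sub>v x = 0\<^sub>v d" if x: "x \<in> carrier_vec d" for x
  proof (rule in_vec_span_orthogonal_eq_0[OF W c[OF x] span[OF x]])
    fix w assume "w \<in> W"
    then show "w \<bullet> (R *\<^sub>v x) = 0"
      using transpose_vec_mult_scalar[OF R x, of w] sym RW W x by auto
  qed
  then have "col R j = 0\<^sub>v d" if "j < d" for j
    using mult_mat_vec_unit_vec[OF R that] that by simp
  then show ?thesis using R by (intro mat_col_eqI) auto
qed

text \<open>The vectors \<open>f i\<close>, enumerated by a bijection, are stacked as the rows of
  \<open>U\<close>.\<close>

lemma exists_mat_form_eq_sum:
  fixes f :: "'i \<Rightarrow> real vec"
  assumes "finite I" "\<And>i. i \<in> I \<Longrightarrow> f i \<in> carrier_vec d"
  shows "\<exists>k. \<exists>U\<in>carrier_mat k d. \<forall>x\<in>carrier_vec d. \<forall>y\<in>carrier_vec d.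
    (U *\<^sub>v x) \<bullet> (U *\<^sub>v y) = (\<Sum>i\<in>I. (f i \<bullet> x) * (f i \<bullet> y))"
proof -
  obtain h where h: "bij_betw h {0..<card I} I" using ex_bij_betw_nat_finite[OF assms(1)] by blast
  define U where "U = mat (card I) d (\<lambda>(m, j). f (h m) $ j)"
  have r: "row U m = f (h m)" if "m < card I" for m
  proof -
    have "h m \<in> I" using h that by (auto simp: bij_betw_def)
    from assms(2)[OF this] show ?thesis using that by (intro eq_vecI) (auto simp: U_def)
  qed
  have U: "U \<in> carrier_mat (card I) d" by (simp add: U_def)
  moreover have "(U *\<^sub>v x) \<bullet> (U *\<^sub>v y) = (\<Sum>i\<in>I. (f i \<bullet> x) * (f i \<bullet> y))" for x y
    using U r by (simp add: scalar_prod_def[of "U *\<^sub>v x"] sum.reindex_bij_betw[OF h, symmetric])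
  ultimately show ?thesis by blast
qed

text \<open>
  The form is written as a sum of squares by diagonal dominance: each ordered pair \<open>(a, b)\<close>
  contributes \<open>\<bar>R\<^sub>a\<^sub>b\<bar> / 2\<close> times the square of \<open>x\<^sub>a + sgn R\<^sub>a\<^sub>b x\<^sub>b\<close>, and the remainder is diagonal.
\<close>

lemma exists_mat_form_eq_id_plus:
  fixes R :: "real mat"
  assumes R: "R \<in> carrier_mat d d" and sym: "transpose_mat R = R"
    and small: "\<And>a. a < d \<Longrightarrow> (\<Sum>b<d. \<bar>R $$ (a, b)\<bar>) \<le> 1"
  shows "\<exists>k. \<exists>U\<in>carrier_mat k d. \<forall>x\<in>carrier_vec d. \<forall>y\<in>carrier_vec d.
    (U *\<^sub>v x) \<bullet> (U *\<^sub>v y) = x \<bullet> y + x \<bullet> (R *\<^sub>v y)"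
proof -
  let ?r = "\<lambda>a b. R $$ (a, b)"
  define D where "D a = (\<Sum>b<d. \<bar>?r a b\<bar>)" for a
  define e where "e a b = sqrt (\<bar>?r a b\<bar> / 2) \<cdot>\<^sub>v (unit_vec d a + sgn (?r a b) \<cdot>\<^sub>v unit_vec d b)" for a b
  \<comment> \<open>These vectors supply the diagonal remainder: the squares from the pairs use up
    \<open>D a\<close> of each diagonal coefficient 1, and \<open>small\<close> makes
    \<open>1 - D a\<close> nonnegative.\<close>
  define g where "g a = sqrt (1 - D a) \<cdot>\<^sub>v unit_vec d a" for a
  define f where "f = case_sum (\<lambda>(a, b). e a b) g"
  let ?I = "({..<d} \<times> {..<d}) <+> {..<d}"
  have rs: "?r b a = ?r a b" if "a < d" "b < d" for a b
    using R that index_transpose_mat(1)[of b R a] sym by simp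
  have sum: "(\<Sum>i\<in>?I. (f i \<bullet> x) * (f i \<bullet> y)) = x \<bullet> y + x \<bullet> (R *\<^sub>v y)"
    if x: "x \<in> carrier_vec d" and y: "y \<in> carrier_vec d" for x y
  proof -
    have e: "e a b \<bullet> z = sqrt (\<bar>?r a b\<bar> / 2) * (z $ a + sgn (?r a b) * z $ b)"
      if "a < d" "b < d" "z \<in> carrier_vec d" for a b z
      using that by (simp add: e_def add_scalar_prod_distrib[of _ d])
    have e2: "(e a b \<bullet> x) * (e a b \<bullet> y) = \<bar>?r a b\<bar> / 2 * (x $ a * y $ a) + \<bar>?r a b\<bar> / 2 * (x $ b * y $ b)
       + ?r a b / 2 * (x $ a * y $ b) + ?r a b / 2 * (x $ b * y $ a)" if "a < d" "b < d" for a b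
    proof -
      define s where "s = sgn (?r a b)"
      define t where "t = \<bar>?r a b\<bar> / 2"
      \<comment> \<open>The second equation also covers a zero entry: there \<open>s * s\<close> is
        0 rather than 1, but \<open>t\<close> is 0 as well.\<close>
      have ts: "t * s = ?r a b / 2" "t * (s * s) = t" and "t \<ge> 0"
        by (simp_all add: s_def t_def sgn_if)
      have "(e a b \<bullet> x) * (e a b \<bullet> y) = (sqrt t * sqrt t) * ((x $ a + s * x $ b) * (y $ a + s * y $ b))"
        unfolding e[OF that x] e[OF that y] s_def t_def by (simp only: mult_ac)
      also have "sqrt t * sqrt t = t" using \<open>t \<ge> 0\<close> by simp
      also have "t * ((x $ a + s * x $ b) * (y $ a + s * y $ b)) =
        t * (x $ a * y $ a) + t * (s * s) * (x $ b * y $ b)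
        + t * s * (x $ a * y $ b) + t * s * (x $ b * y $ a)" by (simp add: algebra_simps)
      finally show ?thesis unfolding ts unfolding t_def .
    qed
    have g: "(g a \<bullet> x) * (g a \<bullet> y) = x $ a * y $ a - D a * (x $ a * y $ a)" if "a < d" for a
    proof -
      have "(g a \<bullet> x) * (g a \<bullet> y) = (sqrt (1 - D a) * sqrt (1 - D a)) * (x $ a * y $ a)"
        using that x y by (simp add: g_def)
      also have "sqrt (1 - D a) * sqrt (1 - D a) = 1 - D a"
        using small[OF that] by (simp add: D_def)
      finally show ?thesis by (simp add: algebra_simps)
    qed
    have d1: "(\<Sum>a<d. \<Sum>b<d. \<bar>?r a b\<bar> / 2 * (x $ a * y $ a)) = (\<Sum>a<d. D a * (x $ a * y $ a)) / 2"
      by (simp add: D_def sum_distrib_right sum_divide_distrib)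
    \<comment> \<open>Exchanging the roles of \<open>a\<close> and \<open>b\<close> and using the
      symmetry of \<open>R\<close>, the two diagonal halves agree; the two mixed halves are treated
      alike below.\<close>
    have "(\<Sum>a<d. \<Sum>b<d. \<bar>?r a b\<bar> / 2 * (x $ b * y $ b)) = (\<Sum>a<d. \<Sum>b<d. \<bar>?r a b\<bar> / 2 * (x $ a * y $ a))"
      by (subst sum.swap) (intro sum.cong refl, simp add: rs)
    note d2 = this[unfolded d1]
    have form: "x \<bullet> (R *\<^sub>v y) = (\<Sum>a<d. \<Sum>b<d. ?r a b * (x $ a * y $ b))"
      by (rule scalar_prod_mult_mat_vec_eq_sum[OF R x y])
    have d3: "(\<Sum>a<d. \<Sum>b<d. ?r a b / 2 * (x $ a * y $ b)) = x \<bullet> (R *\<^sub>v y) / 2"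
      by (simp add: form sum_divide_distrib)
    have "(\<Sum>a<d. \<Sum>b<d. ?r a b / 2 * (x $ b * y $ a)) = (\<Sum>a<d. \<Sum>b<d. ?r a b / 2 * (x $ a * y $ b))"
      by (subst sum.swap) (intro sum.cong refl, simp add: rs)
    note d4 = this[unfolded d3]
    have "(\<Sum>i\<in>?I. (f i \<bullet> x) * (f i \<bullet> y)) =
      (\<Sum>a<d. \<Sum>b<d. (e a b \<bullet> x) * (e a b \<bullet> y)) + (\<Sum>a<d. (g a \<bullet> x) * (g a \<bullet> y))"
      by (simp add: sum.Plus f_def sum.cartesian_product case_prod_unfold comp_def)
    also have "(\<Sum>a<d. \<Sum>b<d. (e a b \<bullet> x) * (e a b \<bullet> y)) = (\<Sum>a<d. D a * (x $ a * y $ a)) + x \<bullet> (R *\<^sub>v y)"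
      using d1 d2 d3 d4 by (simp add: e2 sum.distrib)
    also have "(\<Sum>a<d. (g a \<bullet> x) * (g a \<bullet> y)) = x \<bullet> y - (\<Sum>a<d. D a * (x $ a * y $ a))"
      using y by (simp add: g sum_subtractf scalar_prod_def[of x] lessThan_atLeast0)
    finally show ?thesis by simp
  qed
  have "finite ?I" by simp
  moreover have "f i \<in> carrier_vec d" if "i \<in> ?I" for i
    using that by (auto simp: f_def e_def g_def)
  ultimately show ?thesis using exists_mat_form_eq_sum[of ?I f d] sum by auto
qed

section \<open>The adjacency matrix paired with Gram matrices\<close>

text \<open>The trace identity \<open>tr (A Q Q^T) = tr (Q^T A Q)\<close>; it turns a sum over edges
  into values of the quadratic form at the columns.\<close>

lemma sum_mat_mult_row_gram:
  fixes A Q :: "real mat"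
  assumes A: "A \<in> carrier_mat n n" and Q: "Q \<in> carrier_mat n k"
  shows "(\<Sum>i<n. \<Sum>j<n. A $$ (i, j) * (row Q i \<bullet> row Q j)) = (\<Sum>c<k. col Q c \<bullet> (A *\<^sub>v col Q c))"
proof -
  have "(\<Sum>c<k. col Q c \<bullet> (A *\<^sub>v col Q c)) =
    (\<Sum>c<k. \<Sum>i<n. \<Sum>j<n. A $$ (i, j) * (Q $$ (i, c) * Q $$ (j, c)))"
    using Q by (intro sum.cong refl, subst scalar_prod_mult_mat_vec_eq_sum[OF A]) auto
  also have "\<dots> = (\<Sum>i<n. \<Sum>c<k. \<Sum>j<n. A $$ (i, j) * (Q $$ (i, c) * Q $$ (j, c)))"
    by (rule sum.swap)
  also have "\<dots> = (\<Sum>i<n. \<Sum>j<n. \<Sum>c<k. A $$ (i, j) * (Q $$ (i, c) * Q $$ (j, c)))"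
    by (rule sum.cong[OF refl], rule sum.swap)
  also have "\<dots> = (\<Sum>i<n. \<Sum>j<n. A $$ (i, j) * (row Q i \<bullet> row Q j))"
    using Q by (intro sum.cong refl) (auto simp: scalar_prod_def sum_distrib_left lessThan_atLeast0 intro!: sum.cong)
  finally show ?thesis ..
qed

text \<open>Both sides are the squared Frobenius norm of \<open>Q\<close>.\<close>

lemma sum_row_self_eq_sum_col_self:
  fixes Q :: "real mat"
  assumes Q: "Q \<in> carrier_mat n k"
  shows "(\<Sum>i<n. row Q i \<bullet> row Q i) = (\<Sum>c<k. col Q c \<bullet> col Q c)"
proof -
  have "(\<Sum>i<n. row Q i \<bullet> row Q i) = (\<Sum>i<n. \<Sum>c<k. Q $$ (i, c) * Q $$ (i, c))"
    using Q by (intro sum.cong refl) (auto simp: scalar_prod_def lessThan_atLeast0 intro!: sum.cong)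
  also have "\<dots> = (\<Sum>c<k. \<Sum>i<n. Q $$ (i, c) * Q $$ (i, c))" by (rule sum.swap)
  also have "\<dots> = (\<Sum>c<k. col Q c \<bullet> col Q c)"
    using Q by (intro sum.cong refl) (auto simp: scalar_prod_def lessThan_atLeast0 intro!: sum.cong)
  finally show ?thesis .
qed

text \<open>Equal diagonals give \<open>?S Q\<close> the value of \<open>?S P\<close> plus the sum
  of the terms \<open>?g c\<close>, which are nonnegative. Since \<open>?S Q \<le> ?S P\<close>
  termwise, every \<open>?g c\<close> vanishes, which makes the columns of \<open>Q\<close>
  eigenvectors or zero, and every termwise inequality is an equality.\<close>

lemma dominated_rows_of_least_eigenspace:
  fixes A P Q :: "real mat"
  defines "\<mu> \<equiv> least_eigenvalue A"
  assumes A: "A \<in> carrier_mat n n" and sym: "transpose_mat A = A"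
    and P: "P \<in> carrier_mat n d" and Q: "Q \<in> carrier_mat n k"
    and colP: "\<And>c. c < d \<Longrightarrow> col P c \<in> eigenspace A \<mu>"
    and diag: "\<And>i. i < n \<Longrightarrow> row Q i \<bullet> row Q i = row P i \<bullet> row P i"
    and le: "\<And>i j. i < n \<Longrightarrow> j < n \<Longrightarrow>
      A $$ (i, j) * (row Q i \<bullet> row Q j) \<le> A $$ (i, j) * (row P i \<bullet> row P j)"
  shows "c < k \<Longrightarrow> col Q c \<in> eigenspace A \<mu>"
    and "i < n \<Longrightarrow> j < n \<Longrightarrow>
      A $$ (i, j) * (row Q i \<bullet> row Q j) = A $$ (i, j) * (row P i \<bullet> row P j)"
proof -
  let ?S = "\<lambda>M. \<Sum>i<n. \<Sum>j<n. A $$ (i, j) * (row M i \<bullet> row M j)"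
  have cQ: "col Q c \<in> carrier_vec n" for c using Q by auto
  have cP: "col P c \<in> carrier_vec n" for c using P by auto
  let ?g = "\<lambda>c. col Q c \<bullet> (A *\<^sub>v col Q c) - \<mu> * (col Q c \<bullet> col Q c)"
  have nonneg: "?g c \<ge> 0" for c
    using least_eigenvalue_le_quadratic_form[OF A sym cQ] by (simp add: \<mu>_def)
  have SP: "?S P = \<mu> * (\<Sum>i<n. row P i \<bullet> row P i)"
    unfolding sum_mat_mult_row_gram[OF A P] sum_row_self_eq_sum_col_self[OF P] sum_distrib_left
    using colP cP by (intro sum.cong) (auto simp: eigenspace_def)
  have SQ: "?S Q = \<mu> * (\<Sum>i<n. row P i \<bullet> row P i) + (\<Sum>c<k. ?g c)"
    using sum_row_self_eq_sum_col_self[OF Q] diag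
    by (simp add: sum_mat_mult_row_gram[OF A Q] sum_subtractf sum_distrib_left)
  have "?S Q \<le> ?S P" using le by (intro sum_mono) auto
  moreover have gg: "(\<Sum>c<k. ?g c) \<ge> 0" using nonneg by (intro sum_nonneg) auto
  ultimately have g0: "(\<Sum>c<k. ?g c) = 0" and S: "?S P = ?S Q" using SP SQ by linarith+
  show "col Q c \<in> eigenspace A \<mu>" if "c < k"
  proof -
    have "?g c = 0" using g0 nonneg sum_nonneg_eq_0_iff[of "{..<k}" ?g] that by auto
    then have "A *\<^sub>v col Q c = \<mu> \<cdot>\<^sub>v col Q c"
      using quadratic_form_minimizer_eigenvector[OF A sym _ cQ, of \<mu> c]
        least_eigenvalue_le_quadratic_form[OF A sym] by (simp add: \<mu>_def)
    then show ?thesis using A cQ by (simp add: eigenspace_def)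
  qed
  show "A $$ (i, j) * (row Q i \<bullet> row Q j) = A $$ (i, j) * (row P i \<bullet> row P j)" if "i < n" "j < n"
  proof -
    let ?h = "\<lambda>(i, j). A $$ (i, j) * (row P i \<bullet> row P j) - A $$ (i, j) * (row Q i \<bullet> row Q j)"
    have "(\<Sum>x\<in>{..<n} \<times> {..<n}. ?h x) = ?S P - ?S Q"
      by (simp add: sum.cartesian_product[symmetric] sum_subtractf)
    then have "(\<Sum>x\<in>{..<n} \<times> {..<n}. ?h x) = 0" using S by simp
    then have "?h (i, j) = 0"
      using sum_nonneg_eq_0_iff[of "{..<n} \<times> {..<n}" ?h] le that by fastforce
    then show ?thesis by (simp only: prod.case)
  qed
qed

section \<open>The two directions of the equivalence\<close>

text \<open>For \<open>U\<close> with \<open>U^T U = I + R / m\<close>, the framework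
  \<open>U p\<close> keeps all norms and all inner products along edges, so it is dominated by
  \<open>p\<close>. Equality of the Gram matrices then makes the form of \<open>R\<close> vanish on
  all pairs of framework vectors.\<close>

lemma universally_completable_imp_zero_form:
  assumes p: "\<And>i. i < num_verts G \<Longrightarrow> p i \<in> carrier_vec d"
    and univ: "universally_completable G p"
    and R: "R \<in> carrier_mat d d" and sym: "transpose_mat R = R"
    and im: "mat_image R \<subseteq> vec_span d (p ` {..<num_verts G})"
    and van: "\<And>i j. i < num_verts G \<Longrightarrow> j < num_verts G \<Longrightarrow> adjacent_or_eq G i j \<Longrightarrow>
      p i \<bullet> (R *\<^sub>v p j) = 0"
  shows "R = 0\<^sub>m d d"
proof -
  \<comment> \<open>Division by \<open>m\<close> brings all absolute row sums of \<open>R\<close>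
    down to at most 1; the summand 1 keeps \<open>m\<close> positive even for
    \<open>R = 0\<close>.\<close>
  define m where "m = 1 + (\<Sum>a<d. \<Sum>b<d. \<bar>R $$ (a, b)\<bar>)"
  have m: "m > 0" by (simp add: m_def add_pos_nonneg sum_nonneg)
  let ?R = "(1 / m) \<cdot>\<^sub>m R"
  have "(\<Sum>b<d. \<bar>?R $$ (a, b)\<bar>) \<le> 1" if a: "a < d" for a
  proof -
    have "(\<Sum>b<d. \<bar>R $$ (a, b)\<bar>) \<le> (\<Sum>a<d. \<Sum>b<d. \<bar>R $$ (a, b)\<bar>)"
      by (rule member_le_sum[of a "{..<d}" "\<lambda>a. \<Sum>b<d. \<bar>R $$ (a, b)\<bar>"]) (use a in \<open>auto intro: sum_nonneg\<close>)
    moreover have "(\<Sum>b<d. \<bar>?R $$ (a, b)\<bar>) = (\<Sum>b<d. \<bar>R $$ (a, b)\<bar>) / m"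
      unfolding sum_divide_distrib using R m a by (intro sum.cong) (auto simp: abs_mult)
    ultimately show ?thesis using m by (simp add: m_def)
  qed
  moreover have "transpose_mat ?R = ?R"
  proof (intro eq_matI)
    fix i j assume "i < dim_row ?R" "j < dim_col ?R"
    then show "transpose_mat ?R $$ (i, j) = ?R $$ (i, j)"
      using R index_transpose_mat(1)[of i R j] sym by simp
  qed (use R in auto)
  ultimately obtain k U where U: "U \<in> carrier_mat k d"
    and form: "\<And>x y. x \<in> carrier_vec d \<Longrightarrow> y \<in> carrier_vec d \<Longrightarrow>
      (U *\<^sub>v x) \<bullet> (U *\<^sub>v y) = x \<bullet> y + x \<bullet> (?R *\<^sub>v y)"
    using exists_mat_form_eq_id_plus[of ?R d] R by auto
  have q: "(U *\<^sub>v p i) \<bullet> (U *\<^sub>v p j) = p i \<bullet> p j + p i \<bullet> (R *\<^sub>v p j) / m"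
    if "i < num_verts G" "j < num_verts G" for i j
    using form[OF p p, OF that] R p[OF that(1)] p[OF that(2)]
    by (simp add: scalar_prod_mult_mat_vec_eq_sum[of _ d d] sum_divide_distrib)
  have "framework G k (\<lambda>i. U *\<^sub>v p i)" using U p by (simp add: framework_def)
  moreover have "dominates G p (\<lambda>i. U *\<^sub>v p i)"
    unfolding dominates_def
  proof (intro allI impI)
    fix i j assume ij: "i < num_verts G" "j < num_verts G"
    have "(U *\<^sub>v p i) \<bullet> (U *\<^sub>v p j) = p i \<bullet> p j"
      if "i = j \<or> {i, j} \<in> bars G \<union> cables G \<union> struts G"
      using q[OF ij] van[OF ij] that by (simp add: adjacent_or_eq_def adjacent_def edges_def)
    then show "({i, j} \<in> bars G \<or> i = j \<longrightarrow> (U *\<^sub>v p i) \<bullet> (U *\<^sub>v p j) = p i \<bullet> p j) \<and>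
        ({i, j} \<in> cables G \<longrightarrow> (U *\<^sub>v p i) \<bullet> (U *\<^sub>v p j) \<ge> p i \<bullet> p j) \<and>
        ({i, j} \<in> struts G \<longrightarrow> (U *\<^sub>v p i) \<bullet> (U *\<^sub>v p j) \<le> p i \<bullet> p j)" by auto
  qed
  ultimately have gram: "gram_mat (num_verts G) (\<lambda>i. U *\<^sub>v p i) = gram_mat (num_verts G) p"
    using univ by (auto simp: universally_completable_def)
  have "p i \<bullet> (R *\<^sub>v p j) = 0" if "i < num_verts G" "j < num_verts G" for i j
    using arg_cong[OF gram, of "\<lambda>M. M $$ (i, j)"] q[OF that] that m by (simp add: gram_mat_def)
  then show ?thesis
    using symmetric_mat_eq_0_if_form_vanishes_on_span[OF R sym _ im] p by blast
qed

text \<open>The matrix \<open>R\<close> is built so that its form at \<open>p i\<close>,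
  \<open>p j\<close> is the change of the inner product from \<open>p\<close> to \<open>q\<close>;
  tightness on the edges makes it satisfy the assumption of \<open>rigid\<close>.\<close>

lemma universally_completable_if_zero_form:
  assumes nocab: "cables G = {}"
    and gle: "generalized_least_eigenvalue_framework G d p"
    and rigid: "\<And>R. R \<in> carrier_mat d d \<Longrightarrow> transpose_mat R = R \<Longrightarrow>
      mat_image R \<subseteq> vec_span d (p ` {..<num_verts G}) \<Longrightarrow>
      (\<And>i j. i < num_verts G \<Longrightarrow> j < num_verts G \<Longrightarrow> adjacent_or_eq G i j \<Longrightarrow>
        p i \<bullet> (R *\<^sub>v p j) = 0) \<Longrightarrow> R = 0\<^sub>m d d"
  shows "universally_completable G p"
  unfolding universally_completable_def
proof (intro allI impI)
  fix k q assume fr: "framework G k q" and dom: "dominates G p q"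
  let ?n = "num_verts G" and ?A = "adjacency_mat G"
  have A: "?A \<in> carrier_mat ?n ?n" by (simp add: adjacency_mat_def)
  have symA: "transpose_mat ?A = ?A"
    by (intro eq_matI) (auto simp: adjacency_mat_def adjacent_def insert_commute)
  obtain P where P: "P \<in> carrier_mat ?n d"
    and col_space: "vec_space.col_space ?n P = eigenspace ?A (least_eigenvalue ?A)"
    and Pp: "\<And>i. i < ?n \<Longrightarrow> p i = row P i"
    using gle by (auto simp: generalized_least_eigenvalue_framework_def)
  have eig: "eigenspace ?A (least_eigenvalue ?A) = {P *\<^sub>v x | x. x \<in> carrier_vec d}"
    unfolding col_space[symmetric] vec_space.col_space_eq[OF P] using P by auto
  have p: "p i \<in> carrier_vec d" if "i < ?n" for i using Pp[OF that] P that by auto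
  have colP: "col P c = P *\<^sub>v unit_vec d c" if "c < d" for c
    using mult_mat_vec_unit_vec[OF P that] by simp
  define Q where "Q = mat ?n k (\<lambda>(i, c). q i $ c)"
  have Q: "Q \<in> carrier_mat ?n k" by (simp add: Q_def)
  have Qq: "q i = row Q i" if "i < ?n" for i
    using fr that by (intro eq_vecI) (auto simp: Q_def framework_def)
  have diag: "row Q i \<bullet> row Q i = row P i \<bullet> row P i" if "i < ?n" for i
    using dom that by (simp add: dominates_def Pp Qq)
  \<comment> \<open>Off the edges the coefficient is zero, and bars give equality. Struts give the
    inequality in this direction, whereas cables would reverse it.\<close>
  have le: "?A $$ (i, j) * (row Q i \<bullet> row Q j) \<le> ?A $$ (i, j) * (row P i \<bullet> row P j)"
    if "i < ?n" "j < ?n" for i j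
    using dom that nocab
    by (auto simp: dominates_def Pp Qq adjacency_mat_def adjacent_def edges_def)
  have colPe: "col P c \<in> eigenspace ?A (least_eigenvalue ?A)" if "c < d" for c
    using colP[OF that] unfolding eig by auto
  have colQ: "col Q c \<in> eigenspace ?A (least_eigenvalue ?A)" if "c < k" for c
    by (rule dominated_rows_of_least_eigenspace(1)[OF A symA P Q colPe diag le that])
  have tight: "?A $$ (i, j) * (row Q i \<bullet> row Q j) = ?A $$ (i, j) * (row P i \<bullet> row P j)"
    if "i < ?n" "j < ?n" for i j
    by (rule dominated_rows_of_least_eigenspace(2)[OF A symA P Q colPe diag le that])
  have "\<exists>u\<in>carrier_vec d. col Q c = P *\<^sub>v u" if "c < k" for c
    using colQ[OF that] unfolding eig by auto
  then obtain V where V: "V \<in> carrier_mat ?n k" and QV: "Q = P * (transpose_mat P * V)"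
    using exists_mat_factor_mult_transpose[OF P Q] by auto
  have "\<exists>u\<in>carrier_vec d. col P c = P *\<^sub>v u" if "c < d" for c
    using colP[OF that] by auto
  then obtain Z where Z: "Z \<in> carrier_mat ?n d" and PZ: "P = P * (transpose_mat P * Z)"
    using exists_mat_factor_mult_transpose[OF P P] by auto
  have row: "row M i = transpose_mat B *\<^sub>v p i"
    if "M = P * B" "B \<in> carrier_mat d l" "i < ?n" for M B l i
    using that P by (intro eq_vecI) (auto simp: Pp intro!: comm_scalar_prod[of _ d])
  define U where "U = transpose_mat V * P"
  \<comment> \<open>\<open>T\<close> fixes every \<open>p i\<close>, yet \<open>T^T T\<close> maps
    into the span of the \<open>p i\<close>. The identity in its place would give the same form on
    the \<open>p i\<close>, but its image leaves the span when the \<open>p i\<close> do not span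
    the whole space.\<close>
  define T where "T = transpose_mat Z * P"
  have U: "U \<in> carrier_mat k d" and T: "T \<in> carrier_mat d d" using V Z P by (auto simp: U_def T_def)
  have Ut: "transpose_mat U = transpose_mat P * V" and Tt: "transpose_mat T = transpose_mat P * Z"
    using V Z P by (simp_all add: U_def T_def transpose_mult[of _ _ ?n])
  have Up: "U *\<^sub>v p i = q i" and Tp: "T *\<^sub>v p i = p i" if "i < ?n" for i
    using row[of Q "transpose_mat U" k i] row[of P "transpose_mat T" d i] QV PZ U T that
    by (simp_all add: Ut[symmetric] Tt[symmetric] Qq Pp)
  define R where "R = transpose_mat U * U - transpose_mat T * T"
  have UU: "transpose_mat U * U \<in> carrier_mat d d" and TT: "transpose_mat T * T \<in> carrier_mat d d"
    using U T by auto
  have R: "R \<in> carrier_mat d d" unfolding R_def by (rule minus_carrier_mat[OF TT])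
  have symR: "transpose_mat R = R"
    using U T UU TT by (simp add: R_def transpose_minus[OF UU TT] transpose_mult[of _ d k] transpose_mult[of _ d d])
  have form: "p i \<bullet> (R *\<^sub>v p j) = q i \<bullet> q j - p i \<bullet> p j" if ij: "i < ?n" "j < ?n" for i j
  proof -
    have Rp: "R *\<^sub>v p j = transpose_mat U *\<^sub>v q j - transpose_mat T *\<^sub>v p j"
      using minus_mult_distrib_mat_vec[OF UU TT p[OF ij(2)]] U T p[OF ij(2)] Up[OF ij(2)] Tp[OF ij(2)]
      by (simp add: R_def assoc_mult_mat_vec[of _ d k] assoc_mult_mat_vec[of _ d d])
    have "p i \<bullet> (transpose_mat U *\<^sub>v q j) = q i \<bullet> q j"
      using transpose_vec_mult_scalar[of "transpose_mat U" d k "q j" "p i"] U p[OF ij(1)] Up[OF ij(1)]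
        fr ij by (simp add: framework_def)
    moreover have "p i \<bullet> (transpose_mat T *\<^sub>v p j) = p i \<bullet> p j"
      using transpose_vec_mult_scalar[of "transpose_mat T" d d "p j" "p i"] T p[OF ij(1)] Tp[OF ij(1)]
        p[OF ij(2)] by simp
    moreover have "transpose_mat U *\<^sub>v q j \<in> carrier_vec d" "transpose_mat T *\<^sub>v p j \<in> carrier_vec d"
      unfolding carrier_vec_def using U T by auto
    ultimately show ?thesis
      unfolding Rp using p[OF ij(1)] by (simp add: scalar_prod_minus_distrib[of _ d])
  qed
  have rows: "set (rows P) = p ` {..<?n}"
    using P Pp by (auto simp: rows_def)
  \<comment> \<open>Both \<open>U^T\<close> and \<open>T^T\<close> begin with the factor
    \<open>P^T\<close>, so each value of \<open>R\<close> is a combination of the rows of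
    \<open>P\<close>.\<close>
  have Rx: "R *\<^sub>v x = transpose_mat P *\<^sub>v (V *\<^sub>v (U *\<^sub>v x) - Z *\<^sub>v (T *\<^sub>v x))" if x: "x \<in> carrier_vec d" for x
  proof -
    have Pt: "transpose_mat P \<in> carrier_mat d ?n" using P by simp
    have Ux: "U *\<^sub>v x \<in> carrier_vec k" and Tx: "T *\<^sub>v x \<in> carrier_vec d" using U T x by auto
    have "transpose_mat U * U *\<^sub>v x = transpose_mat P *\<^sub>v (V *\<^sub>v (U *\<^sub>v x))"
      using assoc_mult_mat_vec[OF _ U x, of "transpose_mat U" d] assoc_mult_mat_vec[OF Pt V Ux] U
      by (simp add: Ut[symmetric])
    moreover have "transpose_mat T * T *\<^sub>v x = transpose_mat P *\<^sub>v (Z *\<^sub>v (T *\<^sub>v x))"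
      using assoc_mult_mat_vec[OF _ T x, of "transpose_mat T" d] assoc_mult_mat_vec[OF Pt Z Tx] T
      by (simp add: Tt[symmetric])
    moreover have "V *\<^sub>v (U *\<^sub>v x) \<in> carrier_vec ?n" "Z *\<^sub>v (T *\<^sub>v x) \<in> carrier_vec ?n"
      using V Z Ux Tx by auto
    ultimately show ?thesis
      unfolding R_def minus_mult_distrib_mat_vec[OF UU TT x]
      using mult_minus_distrib_mat_vec[OF Pt] by simp
  qed
  have im: "mat_image R \<subseteq> vec_span d (p ` {..<?n})"
  proof
    fix y assume "y \<in> mat_image R"
    then obtain x where x: "x \<in> carrier_vec d" and y: "y = R *\<^sub>v x"
      using R by (auto simp: mat_image_def)
    have "V *\<^sub>v (U *\<^sub>v x) - Z *\<^sub>v (T *\<^sub>v x) \<in> carrier_vec ?n"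
      unfolding carrier_vec_def using Z by simp
    then show "y \<in> vec_span d (p ` {..<?n})"
      unfolding y Rx[OF x] rows[symmetric] vec_span_rows[OF P] by blast
  qed
  have "p i \<bullet> (R *\<^sub>v p j) = 0" if "i < ?n" "j < ?n" "adjacent_or_eq G i j" for i j
  proof (cases "i = j")
    case True
    then show ?thesis using form[OF that(1,2)] diag that by (simp add: Pp Qq)
  next
    case False
    then have "?A $$ (i, j) = 1" using that by (simp add: adjacency_mat_def adjacent_or_eq_def)
    then show ?thesis using form[OF that(1,2)] tight[OF that(1,2)] that by (simp add: Pp Qq)
  qed
  then have "R = 0\<^sub>m d d" using rigid[OF R symR im] by blast
  then have "q i \<bullet> q j = p i \<bullet> p j" if "i < ?n" "j < ?n" for i j
    using form[OF that] p[OF that(1)] p[OF that(2)]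
    by (simp add: scalar_prod_mult_mat_vec_eq_sum[of _ d d])
  then show "gram_mat ?n q = gram_mat ?n p" by (intro eq_matI) (auto simp: gram_mat_def)
qed

theorem theorem3p4:
  fixes G :: tensegrity and d :: nat and p :: "nat \<Rightarrow> real vec"
  assumes "tensegrity_graph G"
    and "cables G = {}"
    and "generalized_least_eigenvalue_framework G d p"
  shows "universally_completable G p \<longleftrightarrow>
    (\<forall>R \<in> carrier_mat d d.
       transpose_mat R = R \<and> mat_image R \<subseteq> vec_span d (p ` {..<num_verts G}) \<longrightarrow>
       (\<forall>i < num_verts G. \<forall>j < num_verts G. adjacent_or_eq G i j \<longrightarrow> p i \<bullet> (R *\<^sub>v p j) = 0) \<longrightarrow>
       R = 0\<^sub>m d d)"
proof
  assume univ: "universally_completable G p"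
  have "p i \<in> carrier_vec d" if "i < num_verts G" for i
    using assms(3) that by (auto simp: generalized_least_eigenvalue_framework_def)
  then show "\<forall>R \<in> carrier_mat d d.
       transpose_mat R = R \<and> mat_image R \<subseteq> vec_span d (p ` {..<num_verts G}) \<longrightarrow>
       (\<forall>i < num_verts G. \<forall>j < num_verts G. adjacent_or_eq G i j \<longrightarrow> p i \<bullet> (R *\<^sub>v p j) = 0) \<longrightarrow>
       R = 0\<^sub>m d d"
    using universally_completable_imp_zero_form[OF _ univ] by blast
qed (rule universally_completable_if_zero_form[OF assms(2,3)], blast)

end
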